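(* Let $r\in[0,+\infty)$ and let $b>a>0$ be real numbers. Then $$L_r(a,b)+L_{-r}(a,b)<a+b,$$ where $L_r(a,b)$ denotes the generalized logarithmic mean of $a$ and $b$.
   Context: For positive real numbers $a\neq b$ and real $r\notin\{0,1\}$, the generalized logarithmic mean is $$L_r(a,b)=\Big(\frac{b^r-a^r}{r(b-a)}\Big)^{\frac{1}{r-1}},$$ and the values at $r=0,1$ are defined as limits: $L_0(a,b)=\frac{b-a}{\ln b-\ln a}$, $L_1(a,b)=\frac1e\Big(\frac{b^b}{a^a}\Big)^{\frac{1}{b-a}}$. *)

theory Defs
  imports Complex_Main
begin

text \<open>
  Generalized logarithmic mean of two distinct positive reals. The values at
  \<open>r = 0\<close> and \<open>r = 1\<close> are the limits of the general formula there.
  For \<open>a = b\<close> or nonpositive arguments the value is not meaningful.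
\<close>

definition gen_log_mean :: "real \<Rightarrow> real \<Rightarrow> real \<Rightarrow> real" where
  "gen_log_mean r a b =
     (if r = 0 then (b - a) / (ln b - ln a)
      else if r = 1 then (1 / exp 1) * ((b powr b) / (a powr a)) powr (1 / (b - a))
      else ((b powr r - a powr r) / (r * (b - a))) powr (1 / (r - 1)))"

end

theory Submission
  imports Defs
begin

text \<open>
  Normalise to \<open>a = 1 - x\<close>, \<open>b = 1 + x\<close>. If \<open>r \<le> 1\<close>, both means are below the arithmetic mean \<open>1\<close>.
  For \<open>r > 1\<close> the means \<open>Q = L\<^sub>r\<close> and \<open>Y = L\<^sub>-\<^sub>r\<close> satisfy \<open>Y\<^sup>r\<^sup>+\<^sup>1 Q\<^sup>r\<^sup>-\<^sup>1 = (1 - x\<^sup>2)\<^sup>r\<close>. Since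
  \<open>(2 - q)\<^sup>r\<^sup>+\<^sup>1 q\<^sup>r\<^sup>-\<^sup>1\<close> decreases on \<open>[1, 2)\<close>, it suffices to bound \<open>Q\<close> by some \<open>1 + u\<close> at which this
  function is at least \<open>(1 - x\<^sup>2)\<^sup>r\<close>. The choice \<open>u = (sqrt (1 + r\<^sup>2 x\<^sup>2) - 1) / r\<close>, the positive root of
  \<open>r u\<^sup>2 + 2 u = r x\<^sup>2\<close>, works: the second requirement follows from \<open>ln p \<ge> 1 - 1 / p\<close> and
  \<open>ln ((1 + u) / (1 - u)) \<le> 2 u / (1 - u\<^sup>2)\<close>, and \<open>Q < 1 + u\<close> from the monotonicity in \<open>x\<close> of the
  logarithm of \<open>2 r x (1 + u)\<^sup>r\<^sup>-\<^sup>1 / ((1 + x)\<^sup>r - (1 - x)\<^sup>r)\<close>, which tends to \<open>0\<close> as \<open>x \<rightarrow> 0\<close>.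
\<close>

section \<open>Exponential form and homogeneity of the mean\<close>

lemma gen_log_mean_eq_exp:
  fixes r a b :: real
  assumes "0 < a" "a < b" "r \<noteq> 0" "r \<noteq> 1"
  shows "0 < (b powr r - a powr r) / (r * (b - a))"
    and "gen_log_mean r a b = exp (ln ((b powr r - a powr r) / (r * (b - a))) / (r - 1))"
proof -
  show pos: "0 < (b powr r - a powr r) / (r * (b - a))"
  proof (cases "r > 0")
    case True
    then show ?thesis
      using assms powr_less_mono2[of r a b] by (simp add: zero_less_divide_iff)
  next
    case False
    with assms have "b powr r < a powr r"
      using powr_less_mono2_neg[of r a b] by simp
    moreover have "r * (b - a) < 0"
      using False assms by (intro mult_neg_pos) auto
    ultimately show ?thesis
      by (simp add: zero_less_divide_iff)
  qed
  show "gen_log_mean r a b = exp (ln ((b powr r - a powr r) / (r * (b - a))) / (r - 1))"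
    using pos assms unfolding gen_log_mean_def by (simp add: powr_def)
qed

lemma gen_log_mean_one_eq_exp:
  fixes a b :: real
  assumes "0 < a" "a < b"
  shows "gen_log_mean 1 a b = exp ((b * ln b - a * ln a) / (b - a) - 1)"
  using assms by (simp add: gen_log_mean_def powr_def ln_div exp_diff)

text \<open>Allows the arithmetic mean to be scaled to 1. In the generic case the quotient picks up
  the factor \<open>m powr (r - 1)\<close>, whose root of order \<open>r - 1\<close> is
  \<open>m\<close>.\<close>

lemma gen_log_mean_mult:
  fixes r a b m :: real
  assumes "0 < a" "a < b" "0 < m"
  shows "gen_log_mean r (m * a) (m * b) = m * gen_log_mean r a b"
proof -
  have lt: "0 < m * a" "m * a < m * b"
    using assms by auto
  consider "r = 0" | "r = 1" | "r \<noteq> 0" "r \<noteq> 1" by blast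
  then show ?thesis
  proof cases
    case 1
    then show ?thesis
      using assms by (simp add: gen_log_mean_def ln_mult right_diff_distrib)
  next
    case 2
    have "(m * b * ln (m * b) - m * a * ln (m * a)) / (m * b - m * a) - 1
      = ln m + ((b * ln b - a * ln a) / (b - a) - 1)"
      using assms by (simp add: ln_mult field_simps)
    then show ?thesis
      using 2 assms gen_log_mean_one_eq_exp[OF lt] gen_log_mean_one_eq_exp[OF assms(1,2)]
      by (simp only: exp_add exp_ln)
  next
    case 3
    let ?D = "(b powr r - a powr r) / (r * (b - a))"
    have "((m * b) powr r - (m * a) powr r) / (r * (m * b - m * a)) = (m powr r / m) * ?D"
      using assms 3 by (simp add: powr_mult field_simps)
    also have "m powr r / m = m powr (r - 1)"
      using assms by (simp add: powr_diff)
    finally have "ln (((m * b) powr r - (m * a) powr r) / (r * (m * b - m * a))) / (r - 1)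
      = ln m + ln ?D / (r - 1)"
      using assms 3 gen_log_mean_eq_exp(1)[OF assms(1,2) 3] ln_mult_pos[of "m powr (r - 1)" ?D]
      by (simp add: ln_powr add_divide_distrib)
    then show ?thesis
      using 3 assms gen_log_mean_eq_exp(2)[OF lt 3] gen_log_mean_eq_exp(2)[OF assms(1,2) 3]
      by (simp only: exp_add exp_ln)
  qed
qed

section \<open>Means of order at most 1 against the arithmetic mean\<close>

text \<open>The difference of the two sides has derivative (1 + x)^(s-1) + (1 - x)^(s-1) - 2,
  positive by AM-GM because the product (1 - x^2)^(s-1) exceeds 1. Dividing by \<open>s\<close>
  treats both signs of \<open>s\<close> at once.\<close>

lemma powr_diff_gt_linear:
  fixes s x :: real
  assumes "s < 1" "s \<noteq> 0" "0 < x" "x < 1"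
  shows "2 * x < ((1 + x) powr s - (1 - x) powr s) / s"
proof -
  define f where "f = (\<lambda>t::real. ((1 + t) powr s - (1 - t) powr s) / s - 2 * t)"
  have "f 0 < f x"
  proof (rule DERIV_pos_imp_increasing_open[OF \<open>0 < x\<close>])
    fix t :: real assume t: "0 < t" "t < x"
    have "(f has_real_derivative (1 + t) powr (s - 1) + (1 - t) powr (s - 1) - 2) (at t)"
      unfolding f_def using t assms
      by (auto intro!: derivative_eq_intros simp: add_divide_distrib)
    moreover have "2 < (1 + t) powr (s - 1) + (1 - t) powr (s - 1)"
    proof -
      \<comment> \<open>Square roots of the two summands, so that AM-GM becomes
        \<open>0 \<le> (?p - ?q)\<^sup>2\<close>.\<close>
      let ?p = "(1 + t) powr ((s - 1) / 2)" and ?q = "(1 - t) powr ((s - 1) / 2)"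
      have "?p * ?q = ((1 + t) * (1 - t)) powr ((s - 1) / 2)"
        using t assms by (simp add: powr_mult)
      moreover have "1 < ((1 + t) * (1 - t)) powr ((s - 1) / 2)"
      proof -
        have "(1 + t) * (1 - t) < 1"
          using t by (simp add: algebra_simps)
        then show ?thesis
          using t assms powr_less_mono2_neg[of "(s - 1) / 2" "(1 + t) * (1 - t)" 1] by simp
      qed
      moreover have "?p\<^sup>2 = (1 + t) powr (s - 1)" "?q\<^sup>2 = (1 - t) powr (s - 1)"
        using t assms by (simp_all add: power2_eq_square flip: powr_add)
      moreover have "0 \<le> (?p - ?q)\<^sup>2" by simp
      ultimately show ?thesis by (simp add: power2_diff)
    qed
    ultimately show "\<exists>y. (f has_real_derivative y) (at t) \<and> y > 0"
      by force
  next
    show "continuous_on {0..x} f"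
      unfolding f_def using assms by (intro continuous_intros) auto
  qed
  then show ?thesis by (simp add: f_def)
qed

text \<open>The limit case \<open>s = 0\<close> of \<open>powr_diff_gt_linear\<close>.\<close>

lemma ln_diff_gt_linear:
  fixes x :: real
  assumes "0 < x" "x < 1"
  shows "2 * x < ln (1 + x) - ln (1 - x)"
proof -
  define f where "f = (\<lambda>t::real. ln (1 + t) - ln (1 - t) - 2 * t)"
  have "f 0 < f x"
  proof (rule DERIV_pos_imp_increasing_open[OF \<open>0 < x\<close>])
    fix t :: real assume t: "0 < t" "t < x"
    have "(f has_real_derivative 2 * t\<^sup>2 / ((1 + t) * (1 - t))) (at t)"
      unfolding f_def using t assms
      by (auto intro!: derivative_eq_intros simp: field_simps power2_eq_square)
    then show "\<exists>y. (f has_real_derivative y) (at t) \<and> y > 0"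
      using t assms by (intro exI[of _ "2 * t\<^sup>2 / ((1 + t) * (1 - t))"]) simp
  next
    show "continuous_on {0..x} f"
      unfolding f_def using assms by (intro continuous_intros) auto
  qed
  then show ?thesis by (simp add: f_def)
qed

text \<open>Applied at the end to \<open>u\<close> rather than to the normalised variable.\<close>

lemma ln_diff_le:
  fixes x :: real
  assumes "0 < x" "x < 1"
  shows "ln (1 + x) - ln (1 - x) \<le> 2 * x / (1 - x\<^sup>2)"
proof -
  define f where "f = (\<lambda>t::real. 2 * t / (1 - t\<^sup>2) - (ln (1 + t) - ln (1 - t)))"
  have "f 0 < f x"
  proof (rule DERIV_pos_imp_increasing_open[OF \<open>0 < x\<close>])
    fix t :: real assume t: "0 < t" "t < x"
    then have "0 < 1 - t\<^sup>2"
      using assms by (simp add: abs_square_less_1)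
    moreover have "1 / (1 + t) + 1 / (1 - t) = 2 / (1 - t\<^sup>2)"
      using t assms calculation by (simp add: divide_simps) (simp add: algebra_simps power2_eq_square)
    ultimately have "(f has_real_derivative 4 * t\<^sup>2 / (1 - t\<^sup>2)\<^sup>2) (at t)"
      unfolding f_def using t assms
      by (auto intro!: derivative_eq_intros)
        (simp add: power2_eq_square, simp add: divide_simps)
    then show "\<exists>y. (f has_real_derivative y) (at t) \<and> y > 0"
      using t assms \<open>0 < 1 - t\<^sup>2\<close> by (intro exI[of _ "4 * t\<^sup>2 / (1 - t\<^sup>2)\<^sup>2"]) simp
  next
    have "1 - t\<^sup>2 \<noteq> 0" if "t \<in> {0..x}" for t
      using that assms power2_eq_1_iff[of t] by auto
    then show "continuous_on {0..x} f"
      unfolding f_def using assms by (intro continuous_intros) auto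
  qed
  then show ?thesis by (simp add: f_def)
qed

text \<open>Serves the mean of order 1. The difference has derivative -ln (1 - t^2).\<close>

lemma mult_ln_diff_lt:
  fixes x :: real
  assumes "0 < x" "x < 1"
  shows "(1 + x) * ln (1 + x) - (1 - x) * ln (1 - x) < 2 * x"
proof -
  define f where "f = (\<lambda>t::real. 2 * t - ((1 + t) * ln (1 + t) - (1 - t) * ln (1 - t)))"
  have "f 0 < f x"
  proof (rule DERIV_pos_imp_increasing_open[OF \<open>0 < x\<close>])
    fix t :: real assume t: "0 < t" "t < x"
    have "(f has_real_derivative - ln (1 + t) - ln (1 - t)) (at t)"
      unfolding f_def using t assms by (auto intro!: derivative_eq_intros)
    moreover have "ln (1 + t) + ln (1 - t) < 0"
    proof -
      have "ln (1 + t) + ln (1 - t) = ln ((1 + t) * (1 - t))"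
        using t assms by (simp add: ln_mult)
      moreover have "(1 + t) * (1 - t) < 1"
        using t by (simp add: algebra_simps)
      ultimately show ?thesis
        using t assms by simp
    qed
    ultimately show "\<exists>y. (f has_real_derivative y) (at t) \<and> y > 0"
      by force
  next
    show "continuous_on {0..x} f"
      unfolding f_def using assms by (intro continuous_intros) auto
  qed
  then show ?thesis by (simp add: f_def)
qed

lemma gen_log_mean_lt_one:
  fixes s x :: real
  assumes "s \<le> 1" "0 < x" "x < 1"
  shows "gen_log_mean s (1 - x) (1 + x) < 1"
proof -
  have lt: "0 < 1 - x" "1 - x < 1 + x"
    using assms by auto
  consider "s = 0" | "s = 1" | "s \<noteq> 0" "s \<noteq> 1" by blast
  then show ?thesis
  proof cases
    case 1
    then show ?thesis
      using ln_diff_gt_linear[OF assms(2,3)] assms by (simp add: gen_log_mean_def)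
  next
    case 2
    then show ?thesis
      using gen_log_mean_one_eq_exp[OF lt] mult_ln_diff_lt[OF assms(2,3)] assms by simp
  next
    case 3
    let ?D = "((1 + x) powr s - (1 - x) powr s) / (s * (1 + x - (1 - x)))"
    have "?D = ((1 + x) powr s - (1 - x) powr s) / s / (2 * x)"
      by simp
    \<comment> \<open>The outer exponent 1 / (s - 1) is negative, so a quotient above 1 gives a mean
      below 1.\<close>
    then have "1 < ?D"
      using powr_diff_gt_linear[of s x] 3 assms by (simp only: less_divide_eq_1_pos) simp
    then have "ln ?D / (s - 1) < 0"
      using 3 assms by (intro divide_pos_neg) auto
    then show ?thesis
      using gen_log_mean_eq_exp(2)[OF lt 3] by simp
  qed
qed

section \<open>Upper bound for the mean of order r > 1\<close>

lemma mult_sinh_le_sinh_mult: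
  fixes r t :: real
  assumes "1 \<le> r" "0 \<le> t"
  shows "r * sinh t \<le> sinh (r * t)"
proof -
  define f where "f = (\<lambda>t. sinh (r * t) - r * sinh t)"
  have "f 0 \<le> f t"
  proof (rule DERIV_nonneg_imp_nondecreasing[OF \<open>0 \<le> t\<close>])
    fix y assume y: "0 \<le> y" "y \<le> t"
    have "(f has_real_derivative r * (cosh (r * y) - cosh y)) (at y)"
      unfolding f_def by (auto intro!: derivative_eq_intros simp: algebra_simps)
    moreover have "cosh y \<le> cosh (r * y)"
      using y assms by (intro cosh_real_nonneg_le_iff[THEN iffD2]) (auto simp: mult_le_cancel_right1)
    ultimately show "\<exists>z. (f has_real_derivative z) (at y) \<and> 0 \<le> z"
      using assms by (intro exI[of _ "r * (cosh (r * y) - cosh y)"]) simp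
  qed
  then show ?thesis by (simp add: f_def)
qed

text \<open>Writing 1 + x and 1 - x as exp (c + \<theta>) and exp (c - \<theta>), with \<theta> =
  artanh x and exp c = sqrt (1 - x^2), turns both sides into multiples of sinh (r \<theta>) and r
  sinh \<theta>.\<close>

lemma powr_diff_ge:
  fixes r x :: real
  assumes "1 \<le> r" "0 < x" "x < 1"
  shows "2 * r * x * (1 - x\<^sup>2) powr ((r - 1) / 2) \<le> (1 + x) powr r - (1 - x) powr r"
proof -
  define c where "c = (ln (1 + x) + ln (1 - x)) / 2"
  define \<theta> where "\<theta> = (ln (1 + x) - ln (1 - x)) / 2"
  have split: "ln (1 + x) = c + \<theta>" "ln (1 - x) = c - \<theta>"
    by (simp_all add: c_def \<theta>_def field_simps)
  have "0 \<le> \<theta>"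
    using assms by (simp add: \<theta>_def)
  have "1 - x\<^sup>2 = (1 + x) * (1 - x)"
    by (simp add: power2_eq_square algebra_simps)
  then have g: "(1 - x\<^sup>2) powr ((r - 1) / 2) = exp ((r - 1) * c)"
    using assms by (simp add: powr_def ln_mult c_def)
  have "2 * x = exp (ln (1 + x)) - exp (ln (1 - x))"
    using assms by simp
  also have "\<dots> = 2 * exp c * sinh \<theta>"
    by (simp add: split sinh_def exp_add exp_diff exp_minus field_simps)
  finally have x: "2 * x = 2 * exp c * sinh \<theta>" .
  have "(1 + x) powr r - (1 - x) powr r = 2 * exp (r * c) * sinh (r * \<theta>)"
    using assms
    by (simp add: powr_def split sinh_def exp_add exp_diff exp_minus field_simps)
  moreover have "2 * r * x * (1 - x\<^sup>2) powr ((r - 1) / 2) = 2 * exp (r * c) * (r * sinh \<theta>)"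
  proof -
    have "2 * r * x * exp ((r - 1) * c) = r * (2 * x) * exp ((r - 1) * c)"
      by simp
    also have "\<dots> = 2 * exp (r * c) * (r * sinh \<theta>)"
      unfolding x by (simp add: exp_diff left_diff_distrib)
    finally show ?thesis
      unfolding g .
  qed
  moreover have "2 * exp (r * c) * (r * sinh \<theta>) \<le> 2 * exp (r * c) * sinh (r * \<theta>)"
    using mult_sinh_le_sinh_mult[OF \<open>1 \<le> r\<close> \<open>0 \<le> \<theta>\<close>] by simp
  ultimately show ?thesis
    by (simp only:)
qed

text \<open>
  With \<open>T = r artanh x\<close> this is \<open>coth\<^sup>2 T = 1 + 1 / sinh\<^sup>2 T\<close> together with
  \<open>sinh T \<ge> r sinh (artanh x) = r x / sqrt (1 - x\<^sup>2)\<close>.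
\<close>

lemma powr_sum_le_powr_diff:
  fixes r x :: real
  assumes "1 \<le> r" "0 < x" "x < 1"
  shows "r * x * ((1 + x) powr r + (1 - x) powr r)
    \<le> sqrt (1 + (r\<^sup>2 - 1) * x\<^sup>2) * ((1 + x) powr r - (1 - x) powr r)"
proof -
  define P where "P = (1 + x) powr r"
  define N where "N = (1 - x) powr r"
  have x2: "0 < 1 - x\<^sup>2"
    using assms by (simp add: abs_square_less_1)
  have "N \<le> P"
    using assms by (simp add: N_def P_def powr_mono2)
  have "P * N = ((1 + x) * (1 - x)) powr r"
    using assms by (simp add: P_def N_def powr_mult)
  also have "(1 + x) * (1 - x) = 1 - x\<^sup>2"
    by (simp add: power2_eq_square algebra_simps)
  also have "(1 - x\<^sup>2) powr r = (1 - x\<^sup>2) * ((1 - x\<^sup>2) powr ((r - 1) / 2))\<^sup>2"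
    using x2 by (simp add: power2_eq_square powr_diff flip: powr_add)
  finally have PN: "P * N = (1 - x\<^sup>2) * ((1 - x\<^sup>2) powr ((r - 1) / 2))\<^sup>2" .
  have "(2 * r * x * (1 - x\<^sup>2) powr ((r - 1) / 2))\<^sup>2 \<le> (P - N)\<^sup>2"
    using powr_diff_ge[OF assms] assms unfolding P_def N_def by (intro power_mono) auto
  then have "(1 - x\<^sup>2) * (2 * r * x * (1 - x\<^sup>2) powr ((r - 1) / 2))\<^sup>2 \<le> (1 - x\<^sup>2) * (P - N)\<^sup>2"
    using x2 by (intro mult_left_mono) auto
  then have *: "4 * r\<^sup>2 * x\<^sup>2 * (P * N) \<le> (1 - x\<^sup>2) * (P - N)\<^sup>2"
    unfolding PN by (simp add: power_mult_distrib algebra_simps)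
  \<comment> \<open>By \<open>*\<close> the last term is at most (1 - x^2) (P - N)^2, and r^2 x^2 +
    1 - x^2 is the radicand.\<close>
  have "(r * x * (P + N))\<^sup>2 = r\<^sup>2 * x\<^sup>2 * (P - N)\<^sup>2 + 4 * r\<^sup>2 * x\<^sup>2 * (P * N)"
    by (simp add: power2_eq_square algebra_simps)
  also have "\<dots> \<le> (1 + (r\<^sup>2 - 1) * x\<^sup>2) * (P - N)\<^sup>2"
    using * by (simp add: algebra_simps)
  finally have "(r * x * (P + N))\<^sup>2 \<le> (1 + (r\<^sup>2 - 1) * x\<^sup>2) * (P - N)\<^sup>2" .
  then have "\<bar>r * x * (P + N)\<bar> \<le> sqrt ((1 + (r\<^sup>2 - 1) * x\<^sup>2) * (P - N)\<^sup>2)"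
    using real_sqrt_le_mono by fastforce
  then show ?thesis
    using \<open>N \<le> P\<close> by (simp add: real_sqrt_mult P_def N_def)
qed

text \<open>
  The difference of the two sides bounds from below the derivative of the logarithm in
  \<open>ln_powr_diff_less\<close>.
\<close>

lemma sqrt_bound:
  fixes r x :: real
  assumes "1 < r" "0 < x" "x < 1"
  defines "R \<equiv> sqrt (1 + (r\<^sup>2 - 1) * x\<^sup>2)" and "s \<equiv> sqrt (1 + r\<^sup>2 * x\<^sup>2)"
  shows "(R / x - r * x) / (1 - x\<^sup>2) < 1 / x + (r - 1) * (r\<^sup>2 * x / s) / (r - 1 + s)"
proof -
  \<comment> \<open>Multiplied by x (1 - x^2), the claim bounds R - c from above; moreover R^2 - c^2
    factors.\<close>
  define c where "c = 1 + (r - 1) * x\<^sup>2"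
  have x2: "0 < x\<^sup>2" "0 < 1 - x\<^sup>2"
    using assms(1-3) by (auto simp: abs_square_less_1)
  have r2: "1 < r\<^sup>2"
    using assms(1) by simp
  have "1 \<le> c"
    using assms(1) by (simp add: c_def)
  have R2: "R\<^sup>2 = 1 + (r\<^sup>2 - 1) * x\<^sup>2" and s2: "s\<^sup>2 = 1 + r\<^sup>2 * x\<^sup>2" and "0 \<le> R" "0 < s"
    using r2 x2 by (simp_all add: R_def s_def add_pos_nonneg)
  \<comment> \<open>Holds since s^2 = R^2 + x^2; it removes the linear occurrence of
    \<open>s\<close> from \<open>key\<close>.\<close>
  have "s \<le> R + 1"
  proof (rule power2_le_imp_le)
    have "x\<^sup>2 \<le> 1" using x2 by simp
    then show "s\<^sup>2 \<le> (R + 1)\<^sup>2"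
      using \<open>0 \<le> R\<close> R2 s2 by (simp add: power2_sum algebra_simps)
  qed (use \<open>0 \<le> R\<close> in simp)
  have "(R - c) * (R + c) = R\<^sup>2 - c\<^sup>2"
    by (simp add: power2_eq_square algebra_simps)
  also have "\<dots> = (r - 1)\<^sup>2 * x\<^sup>2 * (1 - x\<^sup>2)"
    unfolding R2 c_def by (simp add: power2_eq_square algebra_simps)
  finally have Rc: "R - c = (r - 1)\<^sup>2 * x\<^sup>2 * (1 - x\<^sup>2) / (R + c)"
    using \<open>0 \<le> R\<close> \<open>1 \<le> c\<close> by (simp add: field_simps)
  have "(r - 1) * (s * (r - 1 + s)) = (r - 1)\<^sup>2 * s + (r - 1) * s\<^sup>2"
    by (simp add: power2_eq_square algebra_simps)
  also have "\<dots> \<le> (r - 1)\<^sup>2 * (R + 1) + (r - 1) * s\<^sup>2"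
    using \<open>s \<le> R + 1\<close> by (simp add: mult_left_mono)
  also have "\<dots> \<le> r\<^sup>2 * R + (r - 1)\<^sup>2 + (r - 1) * s\<^sup>2"
  proof -
    have "(r - 1)\<^sup>2 \<le> r\<^sup>2"
      using assms(1) by (intro power_mono) auto
    then show ?thesis
      using mult_right_mono[of "(r - 1)\<^sup>2" "r\<^sup>2" R] \<open>0 \<le> R\<close> by (simp add: algebra_simps)
  qed
  \<comment> \<open>The two sides differ by exactly \<open>r\<close>.\<close>
  also have "\<dots> < r\<^sup>2 * (R + c)"
    using assms(1) unfolding s2 c_def by (simp add: power2_eq_square algebra_simps)
  finally have key: "(r - 1) * (s * (r - 1 + s)) < r\<^sup>2 * (R + c)" .
  have pos: "0 < s * (r - 1 + s)" "0 < R + c"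
    using \<open>0 < s\<close> \<open>0 \<le> R\<close> \<open>1 \<le> c\<close> assms(1) by auto
  have "(r - 1) / (R + c) < r\<^sup>2 / (s * (r - 1 + s))"
    using key pos by (simp add: divide_less_eq less_divide_eq mult.commute)
  then have "((r - 1) * x\<^sup>2 * (1 - x\<^sup>2)) * ((r - 1) / (R + c))
    < ((r - 1) * x\<^sup>2 * (1 - x\<^sup>2)) * (r\<^sup>2 / (s * (r - 1 + s)))"
    using assms(1) x2 by (intro mult_strict_left_mono) auto
  moreover define E where "E = (r - 1) * (r\<^sup>2 * x / s) / (r - 1 + s)"
  moreover have "((r - 1) * x\<^sup>2 * (1 - x\<^sup>2)) * ((r - 1) / (R + c)) = R - c"
    unfolding Rc by (simp add: power2_eq_square)
  moreover have "((r - 1) * x\<^sup>2 * (1 - x\<^sup>2)) * (r\<^sup>2 / (s * (r - 1 + s)))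
    = (1 - x\<^sup>2) * x * E"
    by (simp add: E_def power2_eq_square)
  moreover have "(1 - x\<^sup>2) * x * (1 / x + E) = (1 - x\<^sup>2) + (1 - x\<^sup>2) * x * E"
    using assms(2) by (simp add: distrib_left)
  moreover have "c = 1 - x\<^sup>2 + r * x\<^sup>2"
    by (simp add: c_def algebra_simps)
  ultimately have "R - r * x\<^sup>2 < (1 - x\<^sup>2) * x * (1 / x + E)"
    by linarith
  moreover have "R - r * x\<^sup>2 = (1 - x\<^sup>2) * x * ((R / x - r * x) / (1 - x\<^sup>2))"
    using x2 assms(2) by (simp add: divide_simps) (simp add: power2_eq_square algebra_simps)
  ultimately show ?thesis
    unfolding E_def using x2 assms(2) by (simp only: mult_less_cancel_left_pos mult_pos_pos)
qed

text \<open>This is Q < 1 + u after taking logarithms, as (r - 1 + sqrt (1 + r^2 x^2)) / r = 1 +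
  u.\<close>

lemma ln_powr_diff_less:
  fixes r x :: real
  assumes r: "1 < r" and x: "0 < x" "x < 1"
  shows "ln (((1 + x) powr r - (1 - x) powr r) / (2 * r * x))
    < (r - 1) * ln ((r - 1 + sqrt (1 + r\<^sup>2 * x\<^sup>2)) / r)"
proof -
  define W where "W = (\<lambda>t::real. (1 + t) powr r - (1 - t) powr r)"
  define s where "s = (\<lambda>t::real. sqrt (1 + r\<^sup>2 * t\<^sup>2))"
  \<comment> \<open>Right side minus left side of the claim, up to the additive constant that is the
    limit of \<open>F\<close> at 0.\<close>
  define F where "F = (\<lambda>t. ln t + (r - 1) * ln (r - 1 + s t) - ln (W t))"
  have s_pos: "0 < s t" for t
    by (simp add: s_def add_pos_nonneg)
  have W_pos: "0 < W t" if "0 < t" "t < 1" for t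
    using that r powr_less_mono2[of r "1 - t" "1 + t"] by (simp add: W_def)
  have F_mono: "F y < F z" if "0 < y" "y < z" "z < 1" for y z
  proof (rule DERIV_pos_imp_increasing[OF \<open>y < z\<close>])
    fix t assume "y \<le> t" "t \<le> z"
    then have t: "0 < t" "t < 1"
      using that by auto
    define W' where "W' = r * (1 + t) powr (r - 1) + r * (1 - t) powr (r - 1)"
    have "(W has_real_derivative W') (at t)"
      unfolding W_def W'_def using t by (auto intro!: derivative_eq_intros)
    moreover have "(s has_real_derivative r\<^sup>2 * t / s t) (at t)"
      unfolding s_def using s_pos[of t, unfolded s_def]
      by (auto intro!: derivative_eq_intros simp: divide_simps)
    ultimately have "(F has_real_derivative
        1 / t + (r - 1) * (r\<^sup>2 * t / s t) / (r - 1 + s t) - W' / W t) (at t)"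
      unfolding F_def using W_pos[OF t] s_pos[of t] t r
      by (auto intro!: derivative_eq_intros simp: mult_ac)
    moreover have "W' / W t < 1 / t + (r - 1) * (r\<^sup>2 * t / s t) / (r - 1 + s t)"
    proof -
      define R where "R = sqrt (1 + (r\<^sup>2 - 1) * t\<^sup>2)"
      have t2: "0 < 1 - t\<^sup>2"
        using t by (simp add: abs_square_less_1)
      have fac: "1 - t\<^sup>2 = (1 + t) * (1 - t)"
        by (simp add: power2_eq_square algebra_simps)
      \<comment> \<open>The factor 1 - t^2 raises the powers of order r - 1 to order r, where
        \<open>powr_sum_le_powr_diff\<close> applies.\<close>
      have "(1 - t\<^sup>2) * W' = r * ((1 + t) powr r + (1 - t) powr r) - r * t * W t"
        unfolding W'_def W_def fac using t
        by (simp add: powr_diff divide_simps) (simp add: algebra_simps)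
      moreover have "r * ((1 + t) powr r + (1 - t) powr r) \<le> R / t * W t"
        using powr_sum_le_powr_diff[of r t] r t
        by (simp add: R_def W_def field_simps)
      ultimately have "(1 - t\<^sup>2) * W' \<le> (R / t - r * t) * W t"
        by (simp add: algebra_simps)
      then have "W' / W t \<le> (R / t - r * t) / (1 - t\<^sup>2)"
        using t2 W_pos[OF t] by (simp add: divide_le_eq le_divide_eq mult.commute)
      also have "\<dots> < 1 / t + (r - 1) * (r\<^sup>2 * t / s t) / (r - 1 + s t)"
        using sqrt_bound[OF r t] by (simp add: R_def s_def)
      finally show ?thesis .
    qed
    ultimately show "\<exists>d. (F has_real_derivative d) (at t) \<and> 0 < d"
      by force
  qed
  have "(W has_real_derivative 2 * r) (at 0)"
    unfolding W_def by (auto intro!: derivative_eq_intros)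
  then have "((\<lambda>t. W t / t) \<longlongrightarrow> 2 * r) (at 0)"
    by (simp add: DERIV_def W_def)
  then have "((\<lambda>t. W t / t) \<longlongrightarrow> 2 * r) (at_right 0)"
    by (simp add: filterlim_at_split)
  moreover have "((\<lambda>t. r - 1 + s t) \<longlongrightarrow> r - 1 + s 0) (at_right 0)"
    unfolding s_def by (intro tendsto_intros)
  \<comment> \<open>ln t and ln (W t) diverge separately, so they are merged into ln (W t /
    t).\<close>
  ultimately have "((\<lambda>t. (r - 1) * ln (r - 1 + s t) - ln (W t / t))
      \<longlongrightarrow> (r - 1) * ln r - ln (2 * r)) (at_right 0)"
    using r by (intro tendsto_intros) (auto simp: s_def)
  \<comment> \<open>A limit yields only a weak inequality; comparing at x / 2 first leaves the step
    to x to supply strictness.\<close>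
  moreover have "\<forall>\<^sub>F t in at_right 0. (r - 1) * ln (r - 1 + s t) - ln (W t / t) \<le> F (x / 2)"
    unfolding eventually_at_right_field
  proof (intro exI[of _ "x / 2"] conjI allI impI)
    fix t assume t: "0 < t" "t < x / 2"
    then have "(r - 1) * ln (r - 1 + s t) - ln (W t / t) = F t"
      using W_pos[of t] x by (simp add: F_def ln_div)
    then show "(r - 1) * ln (r - 1 + s t) - ln (W t / t) \<le> F (x / 2)"
      using F_mono[of t "x / 2"] t x by simp
  qed (use x in simp)
  ultimately have "(r - 1) * ln r - ln (2 * r) \<le> F (x / 2)"
    by (rule tendsto_upperbound) simp
  also have "\<dots> < F x"
    using F_mono[of "x / 2" x] x by simp
  finally have "ln (W x) - (ln (2 * r) + ln x) < (r - 1) * (ln (r - 1 + s x) - ln r)"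
    by (simp add: F_def right_diff_distrib)
  moreover have "ln (W x / (2 * r * x)) = ln (W x) - (ln (2 * r) + ln x)"
    using W_pos[OF x] x r by (simp add: ln_div ln_mult_pos)
  moreover have "ln ((r - 1 + s x) / r) = ln (r - 1 + s x) - ln r"
    using s_pos[of x] r by (simp add: ln_div)
  ultimately show ?thesis
    by (simp add: W_def s_def)
qed

section \<open>The orders r and -r together\<close>

text \<open>Logarithmic form of the product relation. Changing the sign of \<open>r\<close> divides
  the quotient by (ab)^r, and the outer exponents are 1 / (r - 1) and -1 / (r + 1).\<close>

lemma gen_log_mean_uminus:
  fixes r a b :: real
  assumes "0 < a" "a < b" "1 < r"
  shows "(r + 1) * ln (gen_log_mean (- r) a b) = r * ln (a * b) - (r - 1) * ln (gen_log_mean r a b)"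
proof -
  let ?D = "\<lambda>r. (b powr r - a powr r) / (r * (b - a))"
  have ab: "0 < a * b" "0 < b"
    using assms by auto
  have D: "?D (- r) = ?D r / (a * b) powr r"
    using assms by (simp add: powr_minus powr_mult divide_simps)
  have "ln (gen_log_mean r a b) = ln (?D r) / (r - 1)"
    using assms gen_log_mean_eq_exp(2)[of a b r] by simp
  moreover have "ln (gen_log_mean (- r) a b) = ln (?D (- r)) / (- r - 1)"
    using assms gen_log_mean_eq_exp(2)[of a b "- r"] by simp
  moreover have "ln (?D (- r)) = ln (?D r) - r * ln (a * b)"
    unfolding D using ab assms gen_log_mean_eq_exp(1)[of a b r]
    by (subst ln_div) (auto simp: ln_powr)
  ultimately show ?thesis
    using assms by (simp add: divide_simps) (simp add: algebra_simps)
qed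

lemma gen_log_mean_add_lt_two:
  fixes r x :: real
  assumes r: "1 < r" and x: "0 < x" "x < 1"
  shows "gen_log_mean r (1 - x) (1 + x) + gen_log_mean (- r) (1 - x) (1 + x) < 2"
proof -
  define Q where "Q = gen_log_mean r (1 - x) (1 + x)"
  define Y where "Y = gen_log_mean (- r) (1 - x) (1 + x)"
  define s where "s = sqrt (1 + r\<^sup>2 * x\<^sup>2)"
  define u where "u = (s - 1) / r"
  have lt: "0 < 1 - x" "1 - x < 1 + x"
    using x by auto
  have Y: "0 < Y" "Y < 1"
    using gen_log_mean_eq_exp(2)[OF lt, of "- r"] gen_log_mean_lt_one[of "- r" x] r x
    by (auto simp: Y_def)
  have s2: "s\<^sup>2 = 1 + r\<^sup>2 * x\<^sup>2"
    by (simp add: s_def)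
  have "1 < s"
    using r x by (simp add: s_def)
  \<comment> \<open>Needed for u < 1, which keeps 2 - q positive for q up to 1 + u.\<close>
  have "s < 1 + r"
  proof (rule power2_less_imp_less)
    have "r\<^sup>2 * x\<^sup>2 \<le> r\<^sup>2"
      using x by (simp add: mult_left_le power_le_one)
    moreover have "(1 + r)\<^sup>2 = 1 + 2 * r + r\<^sup>2"
      by (simp add: power2_sum)
    ultimately show "s\<^sup>2 < (1 + r)\<^sup>2"
      using r s2 by linarith
  qed (use r in simp)
  then have u: "0 < u" "u < 1"
    using \<open>1 < s\<close> r by (auto simp: u_def)
  have u2: "r * u\<^sup>2 + 2 * u = r * x\<^sup>2"
  proof -
    have "r * (r * u\<^sup>2 + 2 * u) = (r * u + 1)\<^sup>2 - 1"
      by (simp add: power2_eq_square algebra_simps)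
    also have "r * u + 1 = s"
      using r by (simp add: u_def)
    finally have "r * (r * u\<^sup>2 + 2 * u) = r * (r * x\<^sup>2)"
      using s2 by (simp add: power2_eq_square)
    then show ?thesis
      using r by simp
  qed
  have Q: "0 < Q" "(r - 1) * ln Q < (r - 1) * ln (1 + u)"
  proof -
    let ?D = "((1 + x) powr r - (1 - x) powr r) / (2 * r * x)"
    have Q_eq: "Q = exp (ln ?D / (r - 1))"
      using gen_log_mean_eq_exp(2)[OF lt, of r] r by (simp add: Q_def mult.assoc mult.left_commute)
    then show "0 < Q" by simp
    have "(r - 1 + s) / r = 1 + u"
      using r by (simp add: u_def field_simps)
    then show "(r - 1) * ln Q < (r - 1) * ln (1 + u)"
      using ln_powr_diff_less[OF r x] r by (simp add: Q_eq s_def)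
  qed
  then have "Q < 1 + u"
    using r u by simp
  have "Q + Y < 2"
  proof (cases "Q \<le> 1")
    case True
    then show ?thesis using Y by simp
  next
    case False
    \<comment> \<open>Logarithm of (2 - q)^(r+1) q^(r-1).\<close>
    define K where "K = (\<lambda>q::real. (r + 1) * ln (2 - q) + (r - 1) * ln q)"
    have "K (1 + u) < K Q"
    proof (rule DERIV_neg_imp_decreasing[OF \<open>Q < 1 + u\<close>])
      fix q assume "Q \<le> q" "q \<le> 1 + u"
      then have q: "1 < q" "q < 2"
        using False u by auto
      have "(K has_real_derivative (r - 1) / q - (r + 1) / (2 - q)) (at q)"
        unfolding K_def using q by (auto intro!: derivative_eq_intros)
      moreover have "(r - 1) / q < r - 1"
        using q r by (simp add: divide_less_eq)
      moreover have "r + 1 < (r + 1) / (2 - q)"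
        using q r by (simp add: less_divide_eq)
      ultimately show "\<exists>d. (K has_real_derivative d) (at q) \<and> d < 0"
        by force
    qed
    moreover have "r * ln (1 - x\<^sup>2) \<le> K (1 + u)"
    proof -
      have x2: "0 < 1 - x\<^sup>2" and w2: "0 < 1 - u\<^sup>2"
        using x u by (auto simp: abs_square_less_1)
      have "ln ((1 - x\<^sup>2) / (1 - u\<^sup>2)) \<le> (1 - x\<^sup>2) / (1 - u\<^sup>2) - 1"
        using x2 w2 by (intro ln_le_minus_one) simp
      also have "\<dots> = (u\<^sup>2 - x\<^sup>2) / (1 - u\<^sup>2)"
        using w2 by (simp add: field_simps)
      finally have "r * ln ((1 - x\<^sup>2) / (1 - u\<^sup>2)) \<le> r * ((u\<^sup>2 - x\<^sup>2) / (1 - u\<^sup>2))"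
        using r by (simp only: mult_le_cancel_left_pos)
      also have "r * ((u\<^sup>2 - x\<^sup>2) / (1 - u\<^sup>2)) = - (2 * u / (1 - u\<^sup>2))"
      proof -
        have "r * (u\<^sup>2 - x\<^sup>2) = - (2 * u)"
          using u2 by (simp add: right_diff_distrib)
        then show ?thesis
          by (metis minus_divide_left times_divide_eq_right)
      qed
      also have "- (2 * u / (1 - u\<^sup>2)) \<le> ln (1 - u) - ln (1 + u)"
        using ln_diff_le[OF u] by simp
      finally have "r * ln (1 - x\<^sup>2) \<le> r * ln (1 - u\<^sup>2) + ln (1 - u) - ln (1 + u)"
        using x2 w2 by (simp add: ln_div algebra_simps)
      also have "1 - u\<^sup>2 = (1 + u) * (1 - u)"
        by (simp add: power2_eq_square algebra_simps)
      also have "ln ((1 + u) * (1 - u)) = ln (1 + u) + ln (1 - u)"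
        using u by (simp add: ln_mult_pos)
      also have "r * (ln (1 + u) + ln (1 - u)) + ln (1 - u) - ln (1 + u) = K (1 + u)"
        by (simp add: K_def algebra_simps)
      finally show ?thesis .
    qed
    moreover have "(r + 1) * ln Y = r * ln (1 - x\<^sup>2) - (r - 1) * ln Q"
      using gen_log_mean_uminus[OF lt r]
      by (simp add: Q_def Y_def power2_eq_square algebra_simps)
    \<comment> \<open>Chains r ln (1 - x^2) \<le> K (1 + u) < K Q and subtracts (r - 1) ln
      Q.\<close>
    ultimately have "(r + 1) * ln Y < (r + 1) * ln (2 - Q)"
      by (simp add: K_def)
    then show ?thesis
      using r Y \<open>Q < 1 + u\<close> u by simp
  qed
  then show ?thesis
    by (simp add: Q_def Y_def)
qed

theorem theorem5p1:
  fixes r a b :: real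
  assumes "r \<ge> 0" and "a > 0" and "b > a"
  shows "gen_log_mean r a b + gen_log_mean (- r) a b < a + b"
proof -
  \<comment> \<open>Dividing by the arithmetic mean \<open>m\<close> moves the endpoints to 1 - x
    and 1 + x.\<close>
  define m where "m = (a + b) / 2"
  define x where "x = (b - a) / (a + b)"
  have x: "0 < x" "x < 1" and m: "0 < m"
    using assms by (auto simp: x_def m_def)
  have a: "a = m * (1 - x)" and b: "b = m * (1 + x)"
    using assms by (auto simp: x_def m_def field_simps)
  have scale: "gen_log_mean t a b = m * gen_log_mean t (1 - x) (1 + x)" for t
    unfolding a b using x m by (intro gen_log_mean_mult) auto
  have "gen_log_mean r (1 - x) (1 + x) + gen_log_mean (- r) (1 - x) (1 + x) < 2"
  proof (cases "r \<le> 1")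
    case True
    then show ?thesis
      using gen_log_mean_lt_one[of r x] gen_log_mean_lt_one[of "- r" x] x assms(1) by simp
  next
    case False
    then show ?thesis
      using gen_log_mean_add_lt_two x by simp
  qed
  then have "m * (gen_log_mean r (1 - x) (1 + x) + gen_log_mean (- r) (1 - x) (1 + x)) < m * 2"
    using m by (simp only: mult_less_cancel_left_pos)
  then show ?thesis
    by (simp add: scale distrib_left m_def)
qed

end
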